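(* Let $0\le c\le 6$ and let $n\ge c+2$ be an integer. In the set of degree sequences of $c$-cyclic graphs on $n$ vertices, partially ordered by majorization $\trianglelefteq$, the maximal elements are exactly the following (pairwise non-comparable) sequences, every degree sequence of a $c$-cyclic graph on $n$ vertices being majorized by at least one of them; and the minimal element (majorized by every degree sequence of a $c$-cyclic graph on $n$ vertices) is the following. $c=0$: maximal $[n-1,1^{n-1}]$; minimal $[2^{n-2},1^2]$. $c=1$: maximal $[n-1,2^2,1^{n-3}]$; minimal $[2^n]$. $c=2$: maximal $[n-1,3,2^2,1^{n-4}]$; minimal $[3^2,2^{n-2}]$. $c=3$: maximal $[n-1,4,2^3,1^{n-5}]$ and $[n-1,3^3,1^{n-4}]$; minimal $[3^4,2^{n-4}]$. $c=4$: maximal $[n-1,5,2^4,1^{n-6}]$ and $[n-1,4,3^2,2,1^{n-5}]$; minimal $[3^6,2^{n-6}]$. $c=5$: maximal $[n-1,6,2^5,1^{n-7}]$, $[n-1,5,3^2,2^2,1^{n-6}]$ and $[n-1,4^2,3^2,1^{n-5}]$; minimal $[4,3^6]$ if $n=7$, and $[3^8,2^{n-8}]$ if $n\ge 8$. $c=6$: maximal $[n-1,7,2^6,1^{n-8}]$, $[n-1,6,3^2,2^3,1^{n-7}]$, $[n-1,5,4,3^2,2,1^{n-6}]$ and $[n-1,4^4,1^{n-5}]$; minimal $[4^2,3^6]$ if $n=8$, $[4,3^8]$ if $n=9$, and $[3^{10},2^{n-10}]$ if $n\ge 10$.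
   Context: All graphs are finite, simple, connected and undirected. A graph with $n$ vertices and $m$ edges is $c$-cyclic if $c=m-n+1$. The degree sequence of a graph is the vector of its vertex degrees in nonincreasing order. The notation $[x_1^{\alpha_1},\dots,x_p^{\alpha_p}]$ denotes the vector with $\alpha_i$ components equal to $x_i$ (here exponents are multiplicities; exponent $1$ is omitted, and exponent $0$ means the entry is absent). For vectors $\mathbf y,\mathbf z\in\mathbb{R}^n$ with nonincreasing components, $\mathbf y\trianglelefteq\mathbf z$ ($\mathbf y$ is majorized by $\mathbf z$) means $\sum_{i=1}^k y_i\le\sum_{i=1}^k z_i$ for $k=1,\dots,n-1$ and $\sum_{i=1}^n y_i=\sum_{i=1}^n z_i$. *)

theory Defs
  imports Main "HOL-Library.Multiset"
begin

definition simple_graph :: "'v set \<Rightarrow> 'v set set \<Rightarrow> bool" where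
  "simple_graph V E \<longleftrightarrow> finite V \<and> (\<forall>e\<in>E. e \<subseteq> V \<and> card e = 2)"

definition connected_graph :: "'v set \<Rightarrow> 'v set set \<Rightarrow> bool" where
  "connected_graph V E \<longleftrightarrow>
     V \<noteq> {} \<and> (\<forall>u\<in>V. \<forall>v\<in>V. (u, v) \<in> {(x, y). {x, y} \<in> E}\<^sup>*)"

definition cyclic_graph :: "nat \<Rightarrow> 'v set \<Rightarrow> 'v set set \<Rightarrow> bool" where
  "cyclic_graph c V E \<longleftrightarrow>
     simple_graph V E \<and> connected_graph V E \<and> int c = int (card E) - int (card V) + 1"

definition vertex_degree :: "'v set set \<Rightarrow> 'v \<Rightarrow> nat" where
  "vertex_degree E v = card {e \<in> E. v \<in> e}"

definition degree_sequence :: "'v set \<Rightarrow> 'v set set \<Rightarrow> nat list" where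
  "degree_sequence V E =
     rev (sorted_list_of_multiset (image_mset (vertex_degree E) (mset_set V)))"

text \<open>Every finite graph is isomorphic to one whose vertices are natural numbers, so
  restricting the vertex type to \<open>nat\<close> loses no degree sequence.\<close>

definition cyclic_degree_sequences :: "nat \<Rightarrow> nat \<Rightarrow> nat list set" where
  "cyclic_degree_sequences c n =
     {degree_sequence V E | (V :: nat set) E. cyclic_graph c V E \<and> card V = n}"

text \<open>Majorization is only defined for vectors of equal length with nonincreasing
  components; it is taken to be false elsewhere.\<close>

definition majorized :: "'a::{linorder, comm_monoid_add} list \<Rightarrow> 'a list \<Rightarrow> bool"
    (infix "\<unlhd>" 50) where
  "y \<unlhd> z \<longleftrightarrow>
     length y = length z \<and> sorted_wrt (\<ge>) y \<and> sorted_wrt (\<ge>) z \<and>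
     (\<forall>k\<in>{1..<length y}. sum_list (take k y) \<le> sum_list (take k z)) \<and>
     sum_list y = sum_list z"

definition maximal_elements :: "nat list set \<Rightarrow> nat list set" where
  "maximal_elements D = {d \<in> D. \<forall>e\<in>D. d \<unlhd> e \<longrightarrow> e = d}"

definition minimal_elements :: "nat list set \<Rightarrow> nat list set" where
  "minimal_elements D = {d \<in> D. \<forall>e\<in>D. e \<unlhd> d \<longrightarrow> e = d}"

text \<open>Run-length notation: \<open>blocks [(x, a), (y, b), \<dots>]\<close> is the vector with \<open>a\<close> components
  equal to \<open>x\<close>, followed by \<open>b\<close> components equal to \<open>y\<close>, and so on.\<close>

definition blocks :: "(nat \<times> nat) list \<Rightarrow> nat list" where
  "blocks ps = concat (map (\<lambda>(x, a). replicate a x) ps)"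

text \<open>In both tables no subtraction truncates as long as \<open>n \<ge> c + 2\<close>; the values for
  \<open>c > 6\<close> are irrelevant.\<close>

definition maximal_sequences :: "nat \<Rightarrow> nat \<Rightarrow> nat list list" where
  "maximal_sequences c n =
    (if c = 0 then [blocks [(n - 1, 1), (1, n - 1)]]
     else if c = 1 then [blocks [(n - 1, 1), (2, 2), (1, n - 3)]]
     else if c = 2 then [blocks [(n - 1, 1), (3, 1), (2, 2), (1, n - 4)]]
     else if c = 3 then
       [blocks [(n - 1, 1), (4, 1), (2, 3), (1, n - 5)],
        blocks [(n - 1, 1), (3, 3), (1, n - 4)]]
     else if c = 4 then
       [blocks [(n - 1, 1), (5, 1), (2, 4), (1, n - 6)],
        blocks [(n - 1, 1), (4, 1), (3, 2), (2, 1), (1, n - 5)]]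
     else if c = 5 then
       [blocks [(n - 1, 1), (6, 1), (2, 5), (1, n - 7)],
        blocks [(n - 1, 1), (5, 1), (3, 2), (2, 2), (1, n - 6)],
        blocks [(n - 1, 1), (4, 2), (3, 2), (1, n - 5)]]
     else if c = 6 then
       [blocks [(n - 1, 1), (7, 1), (2, 6), (1, n - 8)],
        blocks [(n - 1, 1), (6, 1), (3, 2), (2, 3), (1, n - 7)],
        blocks [(n - 1, 1), (5, 1), (4, 1), (3, 2), (2, 1), (1, n - 6)],
        blocks [(n - 1, 1), (4, 4), (1, n - 5)]]
     else [])"

definition minimal_sequence :: "nat \<Rightarrow> nat \<Rightarrow> nat list" where
  "minimal_sequence c n =
    (if c = 0 then blocks [(2, n - 2), (1, 2)]
     else if c = 1 then blocks [(2, n)]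
     else if c = 2 then blocks [(3, 2), (2, n - 2)]
     else if c = 3 then blocks [(3, 4), (2, n - 4)]
     else if c = 4 then blocks [(3, 6), (2, n - 6)]
     else if c = 5 then
       (if n = 7 then blocks [(4, 1), (3, 6)] else blocks [(3, 8), (2, n - 8)])
     else if c = 6 then
       (if n = 8 then blocks [(4, 2), (3, 6)]
        else if n = 9 then blocks [(4, 1), (3, 8)]
        else blocks [(3, 10), (2, n - 10)])
     else [])"

end

theory Submission
  imports Defs
begin

text \<open>Let \<open>P\<^sub>k\<close> be the sum of the \<open>k\<close> largest degrees of a graph with \<open>m\<close> edges. The Erdos--Gallai
  inequalities have the linear form \<open>P\<^sub>k + P\<^sub>k\<^sub>+\<^sub>l \<le> k (k - 1) + k l + 2 m\<close>. For \<open>c \<le> 6\<close> the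
  cases \<open>k \<le> 4\<close>, together with all degrees being positive, already force majorization by one of the
  candidates; which one is decided by \<open>P\<^sub>2\<close> and \<open>P\<^sub>3\<close>. Each candidate is realized by a spanning star
  plus a threshold graph with \<open>c\<close> edges.

  All minimal sequences are balanced, that is, of the form \<open>[(q + 1)\<^sup>r, q\<^sup>n\<^sup>-\<^sup>r]\<close>, and such a vector
  is majorized by every integer vector with the same length and sum. They are realized by a
  Hamiltonian path (\<open>c = 0\<close>) or a Hamiltonian cycle with \<open>c - 1\<close> chords.\<close>

section \<open>Degrees in cyclic graphs\<close>

text \<open>Sorting forgets all but the multiset of degrees, so any listing of the vertices by
  nonincreasing degree yields the degree sequence. Explicit graphs are evaluated this way.\<close>

lemma degree_sequence_eqI:
  assumes "distinct vs" "set vs = V" "sorted_wrt (\<ge>) (map (vertex_degree E) vs)"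
  shows "degree_sequence V E = map (vertex_degree E) vs"
proof -
  let ?ys = "map (vertex_degree E) vs"
  have "mset_set V = mset vs"
    using assms mset_set_set by metis
  moreover have "sort ?ys = rev ?ys"
    by (rule properties_for_sort) (use assms(3) in \<open>auto simp: sorted_wrt_rev\<close>)
  ultimately show ?thesis
    unfolding degree_sequence_def
    by (metis mset_map rev_rev_ident sorted_list_of_multiset_mset)
qed

lemma degree_sequence_enumeration:
  assumes "finite V"
  obtains vs where "distinct vs" "set vs = V"
    "degree_sequence V E = map (vertex_degree E) vs" "sorted_wrt (\<ge>) (map (vertex_degree E) vs)"
proof -
  obtain l where l: "set l = V" "distinct l"
    using assms finite_distinct_list by blast
  let ?vs = "rev (sort_key (vertex_degree E) l)"
  have "sorted_wrt (\<ge>) (map (vertex_degree E) ?vs)"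
    by (simp add: rev_map[symmetric] sorted_wrt_rev)
  with l show thesis
    by (intro that[of ?vs] degree_sequence_eqI) auto
qed

lemma vertex_degree_eq_card_neighbours:
  assumes "simple_graph V E"
  shows "vertex_degree E v = card {u \<in> V. {v, u} \<in> E}"
proof -
  have "bij_betw (\<lambda>u. {v, u}) {u \<in> V. {v, u} \<in> E} {e \<in> E. v \<in> e}"
    unfolding bij_betw_def
  proof
    show "inj_on (\<lambda>u. {v, u}) {u \<in> V. {v, u} \<in> E}"
      by (auto simp: inj_on_def doubleton_eq_iff)
    show "(\<lambda>u. {v, u}) ` {u \<in> V. {v, u} \<in> E} = {e \<in> E. v \<in> e}"
    proof (intro equalityI subsetI)
      fix e assume e: "e \<in> {e \<in> E. v \<in> e}"
      then have "card e = 2" "e \<subseteq> V"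
        using assms by (auto simp: simple_graph_def)
      then obtain a b where "e = {a, b}"
        by (auto simp: card_2_iff)
      with e \<open>e \<subseteq> V\<close> show "e \<in> (\<lambda>u. {v, u}) ` {u \<in> V. {v, u} \<in> E}"
        by (auto simp: image_iff doubleton_eq_iff insert_commute)
    qed auto
  qed
  then show ?thesis
    by (simp add: vertex_degree_def bij_betw_same_card)
qed

lemma simple_graph_no_loop: "simple_graph V E \<Longrightarrow> {v, v} \<notin> E"
  by (auto simp: simple_graph_def)

lemma simple_graph_finite_edges: "simple_graph V E \<Longrightarrow> finite E"
  unfolding simple_graph_def by (meson Pow_iff finite_Pow_iff finite_subset subsetI)

lemma handshake:
  assumes "simple_graph V E"
  shows "(\<Sum>v\<in>V. vertex_degree E v) = 2 * card E"
proof -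
  have "\<forall>e\<in>E. card {v \<in> V. v \<in> e} = 2"
  proof
    fix e assume "e \<in> E"
    then have "{v \<in> V. v \<in> e} = e" "card e = 2"
      using assms by (auto simp: simple_graph_def)
    then show "card {v \<in> V. v \<in> e} = 2" by simp
  qed
  then have "(\<Sum>v\<in>V. card {e \<in> E. v \<in> e}) = 2 * card E"
    using assms simple_graph_finite_edges by (intro sum_multicount) (auto simp: simple_graph_def)
  then show ?thesis
    by (simp add: vertex_degree_def)
qed

lemma connected_vertex_degree_pos:
  assumes "simple_graph V E" "connected_graph V E" "card V \<ge> 2" "v \<in> V"
  shows "vertex_degree E v \<ge> 1"
proof -
  have "V \<noteq> {v}" using assms(3) by auto
  then obtain w where w: "w \<in> V" "w \<noteq> v"
    using assms(4) by blast
  then have "(v, w) \<in> {(x, y). {x, y} \<in> E}\<^sup>*"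
    using assms by (auto simp: connected_graph_def)
  with w obtain y where "{v, y} \<in> E"
    by (auto elim: converse_rtranclE)
  then have "{v, y} \<in> {e \<in> E. v \<in> e}" by simp
  moreover have "finite {e \<in> E. v \<in> e}"
    using simple_graph_finite_edges[OF assms(1)] by simp
  ultimately show ?thesis
    unfolding vertex_degree_def by (metis Suc_leI One_nat_def card_gt_0_iff empty_iff)
qed

text \<open>The Erdos--Gallai inequality, freed of the minima \<open>min (card S) (vertex_degree E u)\<close>: each
  vertex outside \<open>S\<close> is put in \<open>T\<close> or in \<open>U\<close> according to which of the two bounds is used.\<close>

lemma Erdos_Gallai_partition:
  assumes G: "simple_graph V E" and V: "V = S \<union> T \<union> U"
    and disj: "S \<inter> T = {}" "S \<inter> U = {}" "T \<inter> U = {}"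
  shows "(\<Sum>v\<in>S. vertex_degree E v) \<le>
    card S * (card S - 1) + card S * card T + (\<Sum>v\<in>U. vertex_degree E v)"
proof -
  have "finite V" using G by (simp add: simple_graph_def)
  then have fin: "finite S" "finite T" "finite U" using V by auto
  have split_sum: "sum f (S \<union> T \<union> U) = sum f S + sum f T + sum f U" for f :: "'a \<Rightarrow> nat"
    using fin disj by (simp add: sum.union_disjoint Int_Un_distrib2)
  \<comment> \<open>Degrees are row sums of the adjacency matrix, so the sum over \<open>S\<close>
    splits into the blocks \<open>S\<close>-\<open>S\<close>, \<open>S\<close>-\<open>T\<close> and
    \<open>S\<close>-\<open>U\<close>, each bounded separately.\<close>
  have deg: "vertex_degree E v = (\<Sum>u\<in>V. of_bool ({v, u} \<in> E))" for v
    using \<open>finite V\<close> by (simp add: vertex_degree_eq_card_neighbours[OF G] sum.If_cases of_bool_def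
        Int_def)
  have "(\<Sum>v\<in>S. vertex_degree E v) =
    (\<Sum>v\<in>S. (\<Sum>u\<in>S. of_bool ({v, u} \<in> E)) + (\<Sum>u\<in>T. of_bool ({v, u} \<in> E))
      + (\<Sum>u\<in>U. of_bool ({v, u} \<in> E)))"
  proof (rule sum.cong)
    fix v
    show "vertex_degree E v = (\<Sum>u\<in>S. of_bool ({v, u} \<in> E)) + (\<Sum>u\<in>T. of_bool ({v, u} \<in> E))
      + (\<Sum>u\<in>U. of_bool ({v, u} \<in> E))"
      unfolding deg V by (rule split_sum)
  qed simp
  also have "\<dots> = (\<Sum>v\<in>S. \<Sum>u\<in>S. of_bool ({v, u} \<in> E)) + (\<Sum>v\<in>S. \<Sum>u\<in>T. of_bool ({v, u} \<in> E))
      + (\<Sum>v\<in>S. \<Sum>u\<in>U. of_bool ({v, u} \<in> E))"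
    by (simp only: sum.distrib)
  also have "(\<Sum>v\<in>S. \<Sum>u\<in>S. of_bool ({v, u} \<in> E)) \<le> card S * (card S - 1)"
  proof -
    have "(\<Sum>u\<in>S. of_bool ({v, u} \<in> E)) \<le> card S - (1::nat)" if "v \<in> S" for v
    proof -
      have "(\<Sum>u\<in>S. of_bool ({v, u} \<in> E)) = (\<Sum>u\<in>S - {v}. of_bool ({v, u} \<in> E) :: nat)"
        by (rule sum.mono_neutral_right) (use simple_graph_no_loop[OF G] fin in auto)
      also have "\<dots> \<le> (\<Sum>u\<in>S - {v}. 1)"
        by (rule sum_mono) simp
      finally show ?thesis using that by simp
    qed
    from sum_mono[OF this] show ?thesis by simp
  qed
  also have "(\<Sum>v\<in>S. \<Sum>u\<in>T. of_bool ({v, u} \<in> E)) \<le> (\<Sum>v\<in>S. \<Sum>u\<in>T. 1::nat)"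
    by (intro sum_mono) simp
  also have "\<dots> = card S * card T" by simp
  \<comment> \<open>This block is counted from the side of \<open>U\<close>: a vertex there has at
    most its degree many neighbours in \<open>S\<close>.\<close>
  also have "(\<Sum>v\<in>S. \<Sum>u\<in>U. of_bool ({v, u} \<in> E)) = (\<Sum>u\<in>U. \<Sum>v\<in>S. of_bool ({u, v} \<in> E) :: nat)"
    by (subst sum.swap) (simp add: insert_commute)
  also have "\<dots> \<le> (\<Sum>u\<in>U. vertex_degree E u)"
    unfolding deg using V \<open>finite V\<close> by (intro sum_mono sum_mono2) auto
  finally show ?thesis by simp
qed

text \<open>The last fact is \<open>Erdos_Gallai_partition\<close> with \<open>S\<close> the first
  \<open>k\<close> vertices, \<open>T\<close> the next \<open>l\<close> and \<open>U\<close> the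
  rest. Adding the sum of the first \<open>k + l\<close> degrees to both sides turns the sum over
  \<open>U\<close> into the total degree \<open>2 * (n + c) - 2\<close>.\<close>

lemma cyclic_degree_sequences_props:
  assumes "d \<in> cyclic_degree_sequences c n" "n \<ge> 2"
  shows "length d = n" "sorted_wrt (\<ge>) d" "sum_list d + 2 = 2 * (n + c)" "\<forall>x\<in>set d. x \<ge> 1"
    "k + l \<le> n \<Longrightarrow>
      sum_list (take k d) + sum_list (take (k + l) d) + 2 \<le> k * (k - 1) + k * l + 2 * (n + c)"
proof -
  from assms obtain V :: "nat set" and E where d: "d = degree_sequence V E" and V: "card V = n"
    and G: "simple_graph V E" "connected_graph V E" "int c = int (card E) - int (card V) + 1"
    unfolding cyclic_degree_sequences_def cyclic_graph_def by blast
  obtain vs where vs: "distinct vs" "set vs = V" and dvs: "d = map (vertex_degree E) vs"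
    and sorted: "sorted_wrt (\<ge>) d"
    using degree_sequence_enumeration[of V E] G(1) d by (metis simple_graph_def)
  show len: "length d = n"
    using vs V dvs distinct_card by fastforce
  show "sorted_wrt (\<ge>) d" by fact
  have sums: "sum_list (map (vertex_degree E) us) = (\<Sum>v\<in>set us. vertex_degree E v)"
    if "distinct us" for us
    using that by (simp add: sum_list_distinct_conv_sum_set)
  show total: "sum_list d + 2 = 2 * (n + c)"
    using handshake[OF G(1)] vs G(3) V by (simp add: dvs sums)
  show "\<forall>x\<in>set d. x \<ge> 1"
    using connected_vertex_degree_pos[OF G(1,2)] assms(2) V vs dvs by auto
  assume kl: "k + l \<le> n"
  define S where "S = set (take k vs)"
  define T where "T = set (take l (drop k vs))"
  define U where "U = set (drop (k + l) vs)"
  have split: "vs = take k vs @ take l (drop k vs) @ drop (k + l) vs"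
    by (metis append_take_drop_id drop_drop add.commute)
  have V_eq: "V = S \<union> T \<union> U"
    using split vs(2) unfolding S_def T_def U_def by (metis set_append Un_assoc)
  have dist: "distinct (take k vs @ take l (drop k vs) @ drop (k + l) vs)"
    using split vs(1) by metis
  then have disj: "S \<inter> T = {}" "S \<inter> U = {}" "T \<inter> U = {}"
    unfolding S_def T_def U_def by auto
  have "length vs = n" using len dvs by simp
  with kl dist have card: "card S = k" "card T = l"
    unfolding S_def T_def by (auto simp: distinct_card)
  have "sum_list (take k d) = (\<Sum>v\<in>S. vertex_degree E v)"
    using vs(1) by (simp add: dvs take_map sums S_def)
  moreover have "sum_list (drop (k + l) d) = (\<Sum>v\<in>U. vertex_degree E v)"
    using vs(1) by (simp add: dvs drop_map sums U_def)
  moreover have "sum_list (take (k + l) d) + sum_list (drop (k + l) d) = sum_list d"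
    by (metis append_take_drop_id sum_list_append)
  ultimately show "sum_list (take k d) + sum_list (take (k + l) d) + 2 \<le>
      k * (k - 1) + k * l + 2 * (n + c)"
    using Erdos_Gallai_partition[OF G(1) V_eq disj] card total by simp
qed

text \<open>The degrees after the first \<open>k\<close> are at least 1 each, which bounds the tail
  from below by the truncated difference \<open>n - k\<close>.\<close>

lemma cyclic_prefix_sum_le:
  assumes "d \<in> cyclic_degree_sequences c n" "n \<ge> 2"
  shows "sum_list (take k d) + n + 2 \<le> 2 * (n + c) + k"
proof -
  note props = cyclic_degree_sequences_props[OF assms]
  have "sum_list (map (\<lambda>_. 1) (drop k d)) \<le> sum_list (map (\<lambda>x. x) (drop k d))"
    using props(4) by (intro sum_list_mono) (meson in_set_dropD)
  then have "n - k \<le> sum_list (drop k d)"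
    using props(1) by (simp add: sum_list_triv)
  moreover have "sum_list (take k d) + sum_list (drop k d) = sum_list d"
    by (metis append_take_drop_id sum_list_append)
  ultimately show ?thesis using props(3) by simp
qed

section \<open>Majorization\<close>

text \<open>Prefix sums determine a list, each entry being a difference of two consecutive ones. The
  lengths 0 and \<open>length y\<close>, outside the quantifier of the definition, are treated
  separately.\<close>

lemma majorized_antisym:
  assumes "y \<unlhd> z" "z \<unlhd> (y :: nat list)"
  shows "y = z"
proof (rule nth_equalityI)
  show len: "length y = length z"
    using assms by (simp add: majorized_def)
  have take_eq: "sum_list (take k y) = sum_list (take k z)" if k: "k \<le> length y" for k
  proof -
    consider "k = 0" | "k = length y" | "k \<in> {1..<length y}"
      using k by fastforce
    then show ?thesis
    proof cases
      case 3
      then show ?thesis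
        using assms len unfolding majorized_def by (metis le_antisym)
    qed (use assms len in \<open>auto simp: majorized_def\<close>)
  qed
  show "y ! i = z ! i" if "i < length y" for i
    using take_eq[of i] take_eq[of "Suc i"] that len by (simp add: take_Suc_conv_app_nth)
qed

lemma majorized_trans: "x \<unlhd> y \<Longrightarrow> y \<unlhd> z \<Longrightarrow> x \<unlhd> (z :: nat list)"
  unfolding majorized_def
  by (intro conjI ballI; elim conjE) (simp_all, meson atLeastLessThan_iff le_trans)

lemma sorted_wrt_replicate: "sorted_wrt (\<ge>) (replicate m (x :: nat))"
  by (induction m) auto

lemma balanced_majorized:
  fixes d :: "nat list"
  assumes "sorted_wrt (\<ge>) d" "length d = n" "sum_list d = n * q + r" "r \<le> n"
  shows "replicate r (Suc q) @ replicate (n - r) q \<unlhd> d"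
proof -
  \<comment> \<open>Entry \<open>k\<close> decides: if it is at least \<open>q + 1\<close>, so are
    the \<open>k\<close> entries before it; otherwise all entries from \<open>k\<close> on are at
    most \<open>q\<close>, and the known total bounds the prefix from below.\<close>
  have prefix: "k * q + min k r \<le> sum_list (take k d)" if "k < n" for k
  proof (cases "d ! k \<ge> Suc q")
    case True
    have "Suc q \<le> x" if "x \<in> set (take k d)" for x
    proof -
      obtain i where "i < k" "x = d ! i"
        using \<open>x \<in> set (take k d)\<close> by (auto simp: in_set_conv_nth)
      then show ?thesis
        using sorted_wrt_nth_less[OF assms(1), of i k] \<open>k < n\<close> assms(2) True by simp
    qed
    then have "sum_list (map (\<lambda>_. Suc q) (take k d)) \<le> sum_list (map (\<lambda>x. x) (take k d))"
      by (intro sum_list_mono)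
    then show ?thesis
      using \<open>k < n\<close> assms(2) by (simp add: sum_list_triv)
  next
    case False
    have "x \<le> q" if "x \<in> set (drop k d)" for x
    proof -
      obtain i where "i < length (drop k d)" "x = drop k d ! i"
        using \<open>x \<in> set (drop k d)\<close> by (metis in_set_conv_nth)
      then have i: "k + i < n" "x = d ! (k + i)"
        using \<open>k < n\<close> assms(2) by auto
      have "d ! (k + i) \<le> d ! k"
        using sorted_wrt_nth_less[OF assms(1), of k "k + i"] i assms(2) by (cases "i = 0") auto
      with i False show ?thesis by simp
    qed
    then have "sum_list (map (\<lambda>x. x) (drop k d)) \<le> sum_list (map (\<lambda>_. q) (drop k d))"
      by (intro sum_list_mono)
    then have "sum_list (drop k d) \<le> (n - k) * q"
      using assms(2) by (simp add: sum_list_triv)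
    moreover have "sum_list (take k d) + sum_list (drop k d) = n * q + r"
      using assms(3) by (metis append_take_drop_id sum_list_append)
    moreover have "n * q = k * q + (n - k) * q"
      using \<open>k < n\<close> by (metis add_mult_distrib le_add_diff_inverse less_imp_le)
    ultimately show ?thesis by linarith
  qed
  have "sum_list (take k (replicate r (Suc q) @ replicate (n - r) q)) = k * q + min k r"
    if "k \<le> n" for k
  proof (cases "k \<le> r")
    case True
    then show ?thesis by (simp add: sum_list_replicate min_def)
  next
    case False
    then obtain j where "k = r + j" by (metis le_add_diff_inverse nat_le_linear)
    with that have "j \<le> n - r" by simp
    with \<open>k = r + j\<close> show ?thesis
      by (simp add: sum_list_replicate add_mult_distrib)
  qed
  note take_eq = this
  have "sum_list (replicate r (Suc q) @ replicate (n - r) q) = sum_list d"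
    using take_eq[of n] assms by simp
  moreover have "sorted_wrt (\<ge>) (replicate r (Suc q) @ replicate (n - r) q)"
    by (auto simp: sorted_wrt_append sorted_wrt_replicate)
  ultimately show ?thesis
    using assms(1,2,4) prefix take_eq unfolding majorized_def by (simp del: take_append)
qed

section \<open>Realizing degree sequences\<close>

text \<open>Concrete graphs are given by lists of pairs, so that degrees become counts in a list
  which the simplifier can evaluate.\<close>

definition edges_of :: "(nat \<times> nat) list \<Rightarrow> nat set set" where
  "edges_of es = (\<lambda>(a, b). {a, b}) ` set es"

definition incidences :: "(nat \<times> nat) list \<Rightarrow> nat \<Rightarrow> nat" where
  "incidences es v = length (filter (\<lambda>(a, b). a = v \<or> b = v) es)"

lemma incidences_append [simp]: "incidences (xs @ ys) v = incidences xs v + incidences ys v"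
  by (simp add: incidences_def)

lemma edges_of_inj:
  fixes es :: "(nat \<times> nat) list"
  assumes "\<forall>(a, b)\<in>set es. a < b"
  shows "inj_on (\<lambda>(a, b). {a, b}) (set es)"
proof (rule inj_onI, clarify)
  fix a b a' b'
  assume "(a, b) \<in> set es" "(a', b') \<in> set es" "{a, b} = {a', b'}"
  with assms have "a < b" "a' < b'" by blast+
  with \<open>{a, b} = {a', b'}\<close> show "a = a' \<and> b = b'"
    by (auto simp: doubleton_eq_iff)
qed

text \<open>Increasing, distinct pairs list every unordered edge only once, so counting list entries
  counts edges.\<close>

lemma vertex_degree_edges_of:
  assumes "distinct es" "\<forall>(a, b)\<in>set es. a < b"
  shows "vertex_degree (edges_of es) v = incidences es v"
proof -
  have "{e \<in> edges_of es. v \<in> e} = (\<lambda>(a, b). {a, b}) ` set (filter (\<lambda>(a, b). a = v \<or> b = v) es)"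
    by (auto simp: edges_of_def)
  moreover have "inj_on (\<lambda>(a, b). {a, b}) (set (filter (\<lambda>(a, b). a = v \<or> b = v) es))"
    using edges_of_inj[OF assms(2)] by (rule inj_on_subset) auto
  ultimately show ?thesis
    using assms(1) by (simp only: vertex_degree_def incidences_def card_image distinct_card
        distinct_filter)
qed

lemma edges_of_realize:
  assumes "distinct es" "\<forall>(a, b)\<in>set es. a < b \<and> b < n"
    and "connected_graph {..<n} (edges_of es)" "length es + 1 = n + c"
    and "distinct vs" "set vs = {..<n}" "sorted_wrt (\<ge>) (map (incidences es) vs)"
  shows "map (incidences es) vs \<in> cyclic_degree_sequences c n"
proof -
  have lt: "\<forall>(a, b)\<in>set es. a < b" using assms(2) by auto
  have "simple_graph {..<n} (edges_of es)"
    using assms(2) by (auto simp: simple_graph_def edges_of_def)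
  moreover have "card (edges_of es) = length es"
    using assms(1) edges_of_inj[OF lt] by (simp add: edges_of_def card_image distinct_card)
  moreover have "degree_sequence {..<n} (edges_of es) = map (incidences es) vs"
    using degree_sequence_eqI[OF assms(5,6), of "edges_of es"] assms(7)
    by (simp add: vertex_degree_edges_of[OF assms(1) lt] cong: map_cong)
  ultimately show ?thesis
    using assms(3,4) unfolding cyclic_degree_sequences_def cyclic_graph_def
    by (intro CollectI exI[of _ "{..<n}"] exI[of _ "edges_of es"]) simp
qed

text \<open>Descending along smaller neighbours leads from any vertex to 0, and adjacency is
  symmetric.\<close>

lemma edges_of_connected:
  assumes "n > 0" "\<And>i. 0 < i \<Longrightarrow> i < n \<Longrightarrow> \<exists>j<i. (j, i) \<in> set es"
  shows "connected_graph {..<n} (edges_of es)"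
proof -
  let ?R = "{(x, y). {x, y} \<in> edges_of es}"
  have sym: "sym ?R" by (auto simp: sym_def insert_commute)
  have root: "(0, i) \<in> ?R\<^sup>*" if "i < n" for i
    using that
  proof (induction i rule: less_induct)
    case (less i)
    show ?case
    proof (cases "i = 0")
      case False
      then obtain j where j: "j < i" "(j, i) \<in> set es"
        using assms(2) less.prems by blast
      then have "(0, j) \<in> ?R\<^sup>*" using less by simp
      moreover have "(j, i) \<in> ?R" using j by (force simp: edges_of_def)
      ultimately show ?thesis by (rule rtrancl_into_rtrancl)
    qed simp
  qed
  have "(u, v) \<in> ?R\<^sup>*" if "u < n" "v < n" for u v
    using root[OF that(2)] symD[OF sym_rtrancl[OF sym] root[OF that(1)]] by (rule rtrancl_trans[rotated])
  then show ?thesis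
    using assms(1) by (auto simp: connected_graph_def)
qed

lemma incidences_eq_0: "\<forall>(a, b)\<in>set es. a \<noteq> v \<and> b \<noteq> v \<Longrightarrow> incidences es v = 0"
  by (auto simp: incidences_def filter_empty_conv)

text \<open>Here \<open>k\<close> stands for the degree before the extra edges \<open>es\<close> are
  added: 1 at a leaf of the star, 2 on the cycle.\<close>

lemma map_incidences_beyond:
  assumes "\<forall>(a, b)\<in>set es. a < L \<and> b < L"
  shows "map (\<lambda>v. k + incidences es v) [L..<n] = replicate (n - L) k"
proof -
  have "incidences es v = 0" if "L \<le> v" for v
    using assms that by (intro incidences_eq_0) auto
  then have "map (\<lambda>v. k + incidences es v) [L..<n] = map (\<lambda>_. k) [L..<n]"
    by simp
  then show ?thesis by (simp add: map_replicate_const)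
qed

section \<open>Spanning stars with extra edges\<close>

lemma incidences_star:
  "incidences (map (Pair 0) [1..<n]) v = (if v = 0 then n - 1 else if v < n then 1 else 0)"
proof (induction n)
  case (Suc n)
  then show ?case by (cases n) (auto simp: incidences_def)
qed (simp add: incidences_def)

text \<open>Meant for a graph with a dominating vertex: \<open>xs\<close> holds the degrees of the
  vertices with further edges, the edge to the centre included, and the ones are leaves.\<close>

definition star_sequence :: "nat \<Rightarrow> nat list \<Rightarrow> nat list" where
  "star_sequence n xs = (n - 1) # xs @ replicate (n - Suc (length xs)) 1"

lemma sorted_star_sequence:
  assumes "sorted_wrt (\<ge>) xs" "\<forall>x\<in>set xs. 1 \<le> x \<and> x < n" "length xs < n"
  shows "sorted_wrt (\<ge>) (star_sequence n xs)"
  using assms by (auto simp: star_sequence_def sorted_wrt_append sorted_wrt_replicate)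

lemma star_sequence_realizable:
  assumes "distinct fs" "\<forall>(a, b)\<in>set fs. 0 < a \<and> a < b \<and> b \<le> length xs"
    and "map (\<lambda>v. Suc (incidences fs v)) [1..<Suc (length xs)] = xs"
    and "sorted_wrt (\<ge>) xs" "\<forall>x\<in>set xs. x < n" "length xs < n" "length fs = c"
  shows "star_sequence n xs \<in> cyclic_degree_sequences c n"
proof -
  \<comment> \<open>Vertex 0 is the centre. A star is a tree, so the \<open>c\<close> extra edges
    \<open>fs\<close> away from the centre make the graph \<open>c\<close>-cyclic.\<close>
  let ?es = "map (Pair 0) [1..<n] @ fs"
  have "incidences fs 0 = 0"
    using assms(2) by (intro incidences_eq_0) auto
  then have inc: "incidences ?es v = (if v = 0 then n - 1 else Suc (incidences fs v))" if "v < n" for v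
    unfolding incidences_append incidences_star
    using that by auto
  have "\<forall>x\<in>set xs. 1 \<le> x"
    by (subst assms(3)[symmetric]) auto
  with assms(4-6) have sorted: "sorted_wrt (\<ge>) (star_sequence n xs)"
    by (intro sorted_star_sequence) auto
  have "[0..<n] = 0 # [1..<n]"
    using assms(6) upt_conv_Cons[of 0 n] by simp
  then have "map (incidences ?es) [0..<n] = (n - 1) # map (incidences ?es) [1..<n]"
    using inc[of 0] assms(6) by (metis list.simps(9) order.strict_trans1 zero_le)
  also have "map (incidences ?es) [1..<n] = map (\<lambda>v. Suc (incidences fs v)) [1..<n]"
    by (rule map_cong[OF refl]) (use inc in simp)
  also have "map (\<lambda>v. Suc (incidences fs v)) [1..<n] =
      xs @ map (\<lambda>v. Suc (incidences fs v)) [Suc (length xs)..<n]"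
  proof -
    have "[1..<n] = [1..<Suc (length xs)] @ [Suc (length xs)..<n]"
      using assms(6) upt_add_eq_append[of 1 "Suc (length xs)" "n - Suc (length xs)"] by simp
    then show ?thesis by (simp only: map_append assms(3))
  qed
  also have "map (\<lambda>v. Suc (incidences fs v)) [Suc (length xs)..<n] =
      replicate (n - Suc (length xs)) 1"
    using map_incidences_beyond[of fs "Suc (length xs)" 1 n] assms(2) by fastforce
  finally have seq: "map (incidences ?es) [0..<n] = star_sequence n xs"
    unfolding star_sequence_def .
  have "map (incidences ?es) [0..<n] \<in> cyclic_degree_sequences c n"
  proof (rule edges_of_realize)
    show "\<forall>(a, b)\<in>set ?es. a < b \<and> b < n"
      using assms(2,6) by auto
    show "length ?es + 1 = n + c"
      using assms(6,7) by simp
    show "sorted_wrt (\<ge>) (map (incidences ?es) [0..<n])"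
      unfolding seq by (fact sorted)
    show "connected_graph {..<n} (edges_of ?es)"
      using assms(6) by (intro edges_of_connected) auto
    show "distinct ?es"
      using assms(1,2) by (auto simp: distinct_map inj_on_def)
  qed auto
  then show ?thesis by (simp only: seq)
qed

section \<open>Hamiltonian paths and cycles with chords\<close>

lemma incidences_path:
  "incidences (map (\<lambda>i. (i, Suc i)) [0..<m]) v =
    (if 0 < v \<and> v \<le> m then 1 else 0) + (if v < m then 1 else 0)"
  by (induction m) (auto simp: incidences_def)

text \<open>The path runs through the vertices 0 to \<open>m\<close>, and \<open>Suc a < b\<close>
  keeps the chords apart from its edges. The list \<open>vs\<close> reorders the vertices by
  nonincreasing degree \<open>d\<close>.\<close>

lemma path_with_chords_realizable:
  assumes "distinct fs" "\<forall>(a, b)\<in>set fs. Suc a < b \<and> b \<le> m" "length fs = c"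
    and "distinct vs" "set vs = {..m}"
    and "\<And>v. v \<le> m \<Longrightarrow> d v = (if 0 < v then 1 else 0) + (if v < m then 1 else 0) + incidences fs v"
    and "sorted_wrt (\<ge>) (map d vs)"
  shows "map d vs \<in> cyclic_degree_sequences c (Suc m)"
proof -
  let ?es = "map (\<lambda>i. (i, Suc i)) [0..<m] @ fs"
  have seq: "map (incidences ?es) vs = map d vs"
    using assms(5,6) by (auto simp: incidences_path)
  have "map (incidences ?es) vs \<in> cyclic_degree_sequences c (Suc m)"
  proof (rule edges_of_realize)
    show "sorted_wrt (\<ge>) (map (incidences ?es) vs)"
      unfolding seq by (fact assms(7))
    show "\<forall>(a, b)\<in>set ?es. a < b \<and> b < Suc m"
      using assms(2) by auto
    show "connected_graph {..<Suc m} (edges_of ?es)"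
    proof (rule edges_of_connected)
      fix i assume "0 < i" "i < Suc m"
      then show "\<exists>j<i. (j, i) \<in> set ?es"
        by (intro exI[of _ "i - 1"]) (auto simp: image_iff)
    qed simp
    show "distinct ?es"
      using assms(1,2) by (auto simp: distinct_map inj_on_def)
  qed (use assms(3,4,5) in \<open>auto simp: lessThan_Suc_atMost\<close>)
  then show ?thesis by (simp only: seq)
qed

text \<open>The edge from 0 to \<open>n - 1\<close> is one chord of the path and closes it to a
  cycle, so \<open>fs\<close> holds \<open>c - 1\<close> chords. As \<open>L = n\<close> is allowed,
  that edge must be kept out of \<open>fs\<close> explicitly.\<close>

lemma cycle_with_chords_realizable:
  assumes "distinct fs" "\<forall>(a, b)\<in>set fs. Suc a < b \<and> b < L \<and> (a, b) \<noteq> (0, n - 1)"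
    and "Suc (length fs) = c" "L \<le> n" "3 \<le> n"
    and "distinct us" "set us = {..<L}"
    and "sorted_wrt (\<ge>) (map (\<lambda>v. 2 + incidences fs v) us)"
  shows "map (\<lambda>v. 2 + incidences fs v) us @ replicate (n - L) 2 \<in> cyclic_degree_sequences c n"
proof -
  obtain m where n: "n = Suc m" and "2 \<le> m"
    using assms(5) by (cases n) auto
  let ?d = "\<lambda>v. 2 + incidences fs v"
  have rep: "map ?d [L..<n] = replicate (n - L) 2"
    using assms(2) by (intro map_incidences_beyond) auto
  have "map ?d (us @ [L..<n]) \<in> cyclic_degree_sequences c (Suc m)"
  proof (rule path_with_chords_realizable[where fs = "(0, m) # fs"])
    show "distinct ((0, m) # fs)" using assms(1,2) n by auto
    show "\<forall>(a, b)\<in>set ((0, m) # fs). Suc a < b \<and> b \<le> m"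
      using assms(2,4) \<open>2 \<le> m\<close> n by auto
    show "set (us @ [L..<n]) = {..m}"
      using assms(4,7) n ivl_disj_un_one(2)[of L n]
      by (simp add: lessThan_Suc_atMost del: upt_Suc)
    show "?d v = (if 0 < v then 1 else 0) + (if v < m then 1 else 0) + incidences ((0, m) # fs) v"
      if "v \<le> m" for v
      using that \<open>2 \<le> m\<close> by (auto simp: incidences_def)
    show "sorted_wrt (\<ge>) (map ?d (us @ [L..<n]))"
      unfolding map_append rep using assms(8)
      by (auto simp: sorted_wrt_append sorted_wrt_replicate)
    show "length ((0, m) # fs) = c" using assms(3) by simp
    show "distinct (us @ [L..<n])" by (simp add: assms(6,7) ivl_disj_int)
  qed
  then show ?thesis using n rep by simp
qed

section \<open>The maximal sequences\<close>

text \<open>Past \<open>xs\<close> the star sequence consists of ones, and there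
  \<open>cyclic_prefix_sum_le\<close> gives the prefix bound. Only the prefixes up to length
  \<open>length xs + 1\<close> remain as a hypothesis.\<close>

lemma cyclic_majorized_star_sequence:
  assumes "d \<in> cyclic_degree_sequences c n" "c + 2 \<le> n"
    and "length xs \<le> c + 1" "sum_list xs = 2 * c + length xs"
    and "sorted_wrt (\<ge>) xs" "\<forall>x\<in>set xs. 1 \<le> x \<and> x \<le> c + 1"
    and "\<And>k. k \<le> length xs \<Longrightarrow> sum_list (take (Suc k) d) \<le> n - 1 + sum_list (take k xs)"
  shows "d \<unlhd> star_sequence n xs"
proof -
  have "2 \<le> n" using assms(2) by simp
  note d = cyclic_degree_sequences_props[OF assms(1) this]
  have prefix: "sum_list (take (Suc j) d) \<le> sum_list (take (Suc j) (star_sequence n xs))"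
    if "Suc j < n" for j
  proof (cases "j \<le> length xs")
    case True
    then show ?thesis using assms(7) by (simp add: star_sequence_def)
  next
    case False
    then show ?thesis
      using cyclic_prefix_sum_le[OF assms(1) \<open>2 \<le> n\<close>, of "Suc j"] assms(4) that
      by (simp add: star_sequence_def sum_list_replicate)
  qed
  have "sum_list (take k d) \<le> sum_list (take k (star_sequence n xs))" if "k \<in> {1..<n}" for k
    using prefix[of "k - 1"] that by simp
  moreover have "sorted_wrt (\<ge>) (star_sequence n xs)"
    using assms(2,3,5,6) by (intro sorted_star_sequence) auto
  moreover have "length (star_sequence n xs) = n"
    using assms(2,3) by (simp add: star_sequence_def)
  moreover have "sum_list (star_sequence n xs) = sum_list d"
    using assms(2,3,4) d(3) by (simp add: star_sequence_def sum_list_replicate)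
  ultimately show ?thesis
    using d(1,2) by (simp add: majorized_def)
qed

text \<open>The common head \<open>n - 1\<close> cancels, so a single prefix of the tails refutes
  majorization.\<close>

lemma star_sequence_not_majorized:
  assumes "k \<le> length xs" "k \<le> length ys" "Suc k < n" "length xs < n"
    and "sum_list (take k ys) < sum_list (take k xs)"
  shows "\<not> star_sequence n xs \<unlhd> star_sequence n ys"
proof
  assume "star_sequence n xs \<unlhd> star_sequence n ys"
  moreover have "Suc k \<in> {1..<length (star_sequence n xs)}"
    using assms(3,4) by (simp add: star_sequence_def)
  ultimately have "sum_list (take (Suc k) (star_sequence n xs)) \<le>
      sum_list (take (Suc k) (star_sequence n ys))"
    by (auto simp: majorized_def)
  then show False using assms by (simp add: star_sequence_def)
qed

text \<open>The degree sequences of the threshold graphs with \<open>c\<close> edges and no isolated vertex, each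
  entry increased by one for the edge to the dominating vertex.\<close>

definition star_tails :: "nat \<Rightarrow> nat list list" where
  "star_tails c =
    (if c = 0 then [[]]
     else if c = 1 then [[2, 2]]
     else if c = 2 then [[3, 2, 2]]
     else if c = 3 then [[4, 2, 2, 2], [3, 3, 3]]
     else if c = 4 then [[5, 2, 2, 2, 2], [4, 3, 3, 2]]
     else if c = 5 then [[6, 2, 2, 2, 2, 2], [5, 3, 3, 2, 2], [4, 4, 3, 3]]
     else [[7, 2, 2, 2, 2, 2, 2], [6, 3, 3, 2, 2, 2], [5, 4, 3, 3, 2], [4, 4, 4, 4]])"

section \<open>Realizability and incomparability of the candidates\<close>

lemma le_6_cases:
  assumes "c \<le> (6 :: nat)"
  obtains "c = 0" | "c = 1" | "c = 2" | "c = 3" | "c = 4" | "c = 5" | "c = 6"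
  using assms by linarith

lemma maximal_sequences_eq:
  assumes "c \<le> 6" "c + 2 \<le> n"
  shows "maximal_sequences c n = map (star_sequence n) (star_tails c)"
  using assms(1)
  by (cases rule: le_6_cases)
    (simp_all add: maximal_sequences_def star_tails_def blocks_def star_sequence_def numeral_eq_Suc)

lemma star_tails_length:
  assumes "c \<le> 6" "xs \<in> set (star_tails c)"
  shows "length xs \<le> c + 1"
  using assms(1) by (cases rule: le_6_cases) (use assms(2) in \<open>auto simp: star_tails_def\<close>)

text \<open>In every witness vertex 1 is joined to all other vertices that carry extra edges. The
  remaining edges, if any, form a star at vertex 2, except for \<open>[4, 4, 4, 4]\<close>, where
  they complete \<open>K4\<close>.\<close>

lemma star_tails_realizable:
  assumes "c \<le> 6" "c + 2 \<le> n" "xs \<in> set (star_tails c)"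
  shows "star_sequence n xs \<in> cyclic_degree_sequences c n"
proof -
  have realize: "star_sequence n xs \<in> cyclic_degree_sequences c n"
    if "distinct fs \<and> (\<forall>(a, b)\<in>set fs. 0 < a \<and> a < b \<and> b \<le> length xs) \<and>
      map (\<lambda>v. Suc (incidences fs v)) [1..<Suc (length xs)] = xs \<and>
      sorted_wrt (\<ge>) xs \<and> (\<forall>x\<in>set xs. x \<le> c + 1) \<and> length fs = c" for fs
    using that assms(2) star_tails_length[OF assms(1,3)]
    by (intro star_sequence_realizable[of fs]) auto
  from assms(1) show ?thesis
  proof (cases rule: le_6_cases)
    case 1
    with assms(3) have "xs = []" by (simp add: star_tails_def)
    with 1 show ?thesis by (intro realize[of "[]"]) simp
  next
    case 2
    with assms(3) have "xs = [2, 2]" by (simp add: star_tails_def)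
    with 2 show ?thesis by (intro realize[of "[(1,2)]"]) (simp add: incidences_def)
  next
    case 3
    with assms(3) have "xs = [3, 2, 2]" by (simp add: star_tails_def)
    with 3 show ?thesis by (intro realize[of "[(1,2),(1,3)]"]) (simp add: incidences_def)
  next
    case 4
    with assms(3) consider "xs = [4, 2, 2, 2]" | "xs = [3, 3, 3]"
      by (auto simp: star_tails_def)
    then show ?thesis
    proof cases
      case 1
      with 4 show ?thesis by (intro realize[of "[(1,2),(1,3),(1,4)]"]) (simp add: incidences_def)
    next
      case 2
      with 4 show ?thesis by (intro realize[of "[(1,2),(1,3),(2,3)]"]) (simp add: incidences_def)
    qed
  next
    case 5
    with assms(3) consider "xs = [5, 2, 2, 2, 2]" | "xs = [4, 3, 3, 2]"
      by (auto simp: star_tails_def)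
    then show ?thesis
    proof cases
      case 1
      with 5 show ?thesis
        by (intro realize[of "[(1,2),(1,3),(1,4),(1,5)]"]) (simp add: incidences_def)
    next
      case 2
      with 5 show ?thesis
        by (intro realize[of "[(1,2),(1,3),(1,4),(2,3)]"]) (simp add: incidences_def)
    qed
  next
    case 6
    with assms(3) consider "xs = [6, 2, 2, 2, 2, 2]" | "xs = [5, 3, 3, 2, 2]" | "xs = [4, 4, 3, 3]"
      by (auto simp: star_tails_def)
    then show ?thesis
    proof cases
      case 1
      with 6 show ?thesis
        by (intro realize[of "[(1,2),(1,3),(1,4),(1,5),(1,6)]"]) (simp add: incidences_def)
    next
      case 2
      with 6 show ?thesis
        by (intro realize[of "[(1,2),(1,3),(1,4),(1,5),(2,3)]"]) (simp add: incidences_def)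
    next
      case 3
      with 6 show ?thesis
        by (intro realize[of "[(1,2),(1,3),(1,4),(2,3),(2,4)]"]) (simp add: incidences_def)
    qed
  next
    case 7
    with assms(3) consider "xs = [7, 2, 2, 2, 2, 2, 2]" | "xs = [6, 3, 3, 2, 2, 2]"
      | "xs = [5, 4, 3, 3, 2]" | "xs = [4, 4, 4, 4]"
      by (auto simp: star_tails_def)
    then show ?thesis
    proof cases
      case 1
      with 7 show ?thesis
        by (intro realize[of "[(1,2),(1,3),(1,4),(1,5),(1,6),(1,7)]"]) (simp add: incidences_def)
    next
      case 2
      with 7 show ?thesis
        by (intro realize[of "[(1,2),(1,3),(1,4),(1,5),(1,6),(2,3)]"]) (simp add: incidences_def)
    next
      case 3
      with 7 show ?thesis
        by (intro realize[of "[(1,2),(1,3),(1,4),(1,5),(2,3),(2,4)]"]) (simp add: incidences_def)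
    next
      case 4
      with 7 show ?thesis
        by (intro realize[of "[(1,2),(1,3),(1,4),(2,3),(2,4),(3,4)]"]) (simp add: incidences_def)
    qed
  qed
qed

lemma star_tails_incomparable:
  assumes "c \<le> 6" "c + 2 \<le> n" "xs \<in> set (star_tails c)" "ys \<in> set (star_tails c)" "xs \<noteq> ys"
  shows "\<not> star_sequence n xs \<unlhd> star_sequence n ys"
proof -
  \<comment> \<open>Along each list the first entry decreases, which \<open>k = 1\<close> detects,
    while a longer prefix sum increases, which \<open>k = 3\<close> or \<open>k = 4\<close> detects.
    The bound \<open>k \<le> c\<close> later gives \<open>Suc k < n\<close>.\<close>
  have "\<forall>xs\<in>set (star_tails c). \<forall>ys\<in>set (star_tails c). xs \<noteq> ys \<longrightarrow>
      (\<exists>k\<in>{1, 3, 4}. k \<le> c \<and> k \<le> length xs \<and> k \<le> length ys \<and>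
        sum_list (take k ys) < sum_list (take k xs))"
    using assms(1) by (cases rule: le_6_cases) (simp_all add: star_tails_def)
  with assms(3-5) obtain k where "k \<le> c" "k \<le> length xs" "k \<le> length ys"
    "sum_list (take k ys) < sum_list (take k xs)" by blast
  with assms(2) star_tails_length[OF assms(1,3)] show ?thesis
    by (intro star_sequence_not_majorized[of k]) auto
qed

lemma distinct_star_tails: "distinct (star_tails c)"
  by (simp add: star_tails_def)

text \<open>Recursive, so that for a concrete list the simplifier unfolds it into one linear
  inequality for each prefix.\<close>

primrec prefix_le :: "(nat \<Rightarrow> nat) \<Rightarrow> nat \<Rightarrow> nat \<Rightarrow> nat list \<Rightarrow> bool" where
  "prefix_le P k b [] \<longleftrightarrow> P k \<le> b"
| "prefix_le P k b (x # xs) \<longleftrightarrow> P k \<le> b \<and> prefix_le P (k + 1) (b + x) xs"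

lemma prefix_le_iff:
  "prefix_le P k b xs \<longleftrightarrow> (\<forall>j\<le>length xs. P (k + j) \<le> b + sum_list (take j xs))"
proof (induction xs arbitrary: k b)
  case (Cons x xs)
  have "(\<forall>j\<le>Suc m. Q j) \<longleftrightarrow> Q 0 \<and> (\<forall>j\<le>m. Q (Suc j))" for Q m
    by (metis Suc_le_mono not0_implies_Suc zero_le)
  from this[of "length xs" "\<lambda>j. P (k + j) \<le> b + sum_list (take j (x # xs))"]
  show ?case by (simp add: Cons.IH add.assoc)
qed simp

section \<open>Every degree sequence lies below a candidate\<close>

lemma majorized_by_star_tail:
  assumes c: "c \<le> 6" "c + 2 \<le> n" and d: "d \<in> cyclic_degree_sequences c n"
  shows "\<exists>xs\<in>set (star_tails c). d \<unlhd> star_sequence n xs"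
proof -
  define P where "P k = sum_list (take k d)" for k
  have n: "2 \<le> n" using c(2) by simp
  note props = cyclic_degree_sequences_props[OF d n]
  \<comment> \<open>Prefix sums are constant beyond length \<open>n\<close> while the right-hand
    side grows with \<open>l\<close>, so the inequality extends to all \<open>l\<close> and can be
    used with fixed numerals for every \<open>n\<close>.\<close>
  have eg: "P k + P (k + l) + 2 \<le> k * (k - 1) + k * l + 2 * (n + c)" if "k \<le> n" for k l
  proof (cases "k + l \<le> n")
    case True
    then show ?thesis unfolding P_def by (rule props(5))
  next
    case False
    have "P k + P (k + (n - k)) + 2 \<le> k * (k - 1) + k * (n - k) + 2 * (n + c)"
      using that unfolding P_def by (intro props(5)) simp
    moreover have "k * (n - k) \<le> k * l" using False by (intro mult_le_mono2) simp
    moreover have "P (k + (n - k)) = P (k + l)" using False props(1) that by (simp add: P_def)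
    ultimately show ?thesis by linarith
  qed
  have total: "P k + n + 2 \<le> 2 * (n + c) + k" for k
    unfolding P_def by (rule cyclic_prefix_sum_le[OF d n])
  \<comment> \<open>With \<open>l = n - 1\<close> the second prefix sum is the total degree, which
    leaves the bound \<open>n - 1\<close> on the largest degree.\<close>
  have P1: "P 1 + 1 \<le> n"
    using eg[of 1 "n - 1"] props(1,3) n by (simp add: P_def)
  have maj: "\<exists>xs\<in>set (star_tails c). d \<unlhd> star_sequence n xs"
    if "prefix_le P 1 (n - 1) xs" "xs \<in> set (star_tails c)"
      "sum_list xs = 2 * c + length xs \<and> sorted_wrt (\<ge>) xs \<and>
      (\<forall>x\<in>set xs. 1 \<le> x \<and> x \<le> c + 1)" for xs
    using cyclic_majorized_star_sequence[OF d c(2) star_tails_length[OF c(1) that(2)]] that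
    unfolding prefix_le_iff by (auto simp: P_def)
  \<comment> \<open>The cases \<open>k = 2, 3, 4\<close>, where the conditions on \<open>c\<close>
    ensure \<open>k \<le> n\<close>. For \<open>l = 0\<close> both prefix sums coincide and the
    bound is halved.\<close>
  have P2: "P 2 + P (2 + l) \<le> 2 * l + 2 * (n + c)" for l
    using eg[of 2 l] n by simp
  have P3: "P 3 + P (3 + l) \<le> 4 + 3 * l + 2 * (n + c)" if "c > 0" for l
    using eg[of 3 l] that c(2) by simp
  have P2_le: "P 2 \<le> n + c"
    using P2[of 0] by simp
  have P3_le: "P 3 \<le> n + c + 2" if "c > 0"
    using P3[OF that, of 0] by simp
  have P4: "P 4 \<le> 5 + n + c" if "c > 1"
    using eg[of 4 0] that c(2) by simp
  from c(1) show ?thesis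
  proof (cases rule: le_6_cases)
    case 1
    note facts = P1
    have "prefix_le P 1 (n - 1) []"
      unfolding prefix_le.simps using facts c(2) 1
      by simp
    then show ?thesis
      by (rule maj) (simp_all add: 1 star_tails_def)
  next
    case 2
    note facts = P1 P2_le total[of 3]
    have "prefix_le P 1 (n - 1) [2, 2]"
      unfolding prefix_le.simps using facts c(2) 2
      by (intro conjI; simp del: One_nat_def)
    then show ?thesis
      by (rule maj) (simp_all add: 2 star_tails_def)
  next
    case 3
    note facts = P1 P2_le P2[of 1] P3_le P4 total[of 3] total[of 4]
    have "prefix_le P 1 (n - 1) [3, 2, 2]"
      unfolding prefix_le.simps using facts c(2) 3
      by (intro conjI; simp del: One_nat_def)
    then show ?thesis
      by (rule maj) (simp_all add: 3 star_tails_def)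
  next
    case 4
    note facts = P1 P2_le P2[of 1] P2[of 2] P2[of 3] P3_le P3[of 1] P4 total[of 3] total[of 4] total[of 5]
    \<comment> \<open>If \<open>P 2\<close> attains its maximum \<open>n + c\<close>, the case
      \<open>k = 2\<close> gives \<open>P (2 + l) \<le> n + c + 2 * l\<close>, the prefix sums of
      the first candidate. The same holds for the larger \<open>c\<close> below.\<close>
    consider "P 2 = n + 3"
      | "P 2 \<le> n + 2"
      using P2_le 4 by linarith
    then show ?thesis
    proof cases
      case sub: 1
      have "prefix_le P 1 (n - 1) [4, 2, 2, 2]"
        unfolding prefix_le.simps using facts c(2) 4 sub
        by (intro conjI; simp del: One_nat_def)
      then show ?thesis
        by (rule maj) (simp_all add: 4 star_tails_def)
    next
      case sub: 2
      have "prefix_le P 1 (n - 1) [3, 3, 3]"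
        unfolding prefix_le.simps using facts c(2) 4 sub
        by (intro conjI; simp del: One_nat_def)
      then show ?thesis
        by (rule maj) (simp_all add: 4 star_tails_def)
    qed
  next
    case 5
    note facts = P1 P2_le P2[of 1] P2[of 2] P2[of 3] P2[of 4] P3_le P3[of 1] P3[of 2] P4
      total[of 3] total[of 4] total[of 5] total[of 6]
    consider "P 2 = n + 4"
      | "P 2 \<le> n + 3"
      using P2_le 5 by linarith
    then show ?thesis
    proof cases
      case sub: 1
      have "prefix_le P 1 (n - 1) [5, 2, 2, 2, 2]"
        unfolding prefix_le.simps using facts c(2) 5 sub
        by (intro conjI; simp del: One_nat_def)
      then show ?thesis
        by (rule maj) (simp_all add: 5 star_tails_def)
    next
      case sub: 2
      have "prefix_le P 1 (n - 1) [4, 3, 3, 2]"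
        unfolding prefix_le.simps using facts c(2) 5 sub
        by (intro conjI; simp del: One_nat_def)
      then show ?thesis
        by (rule maj) (simp_all add: 5 star_tails_def)
    qed
  next
    case 6
    note facts = P1 P2_le P2[of 1] P2[of 2] P2[of 3] P2[of 4] P2[of 5] P3_le P3[of 1] P3[of 2] P4 total[of 3] total[of 4] total[of 5] total[of 6] total[of 7]
    \<comment> \<open>The middle case uses \<open>P3_le\<close> for the prefix of length 3 and
      \<open>k = 2\<close> for the later ones; the last case rests on \<open>P3_le\<close>,
      \<open>P4\<close> and the positivity bound \<open>total\<close>.\<close>
    consider "P 2 = n + 5"
      | "P 2 = n + 4"
      | "P 2 \<le> n + 3"
      using P2_le 6 by linarith
    then show ?thesis
    proof cases
      case sub: 1
      have "prefix_le P 1 (n - 1) [6, 2, 2, 2, 2, 2]"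
        unfolding prefix_le.simps using facts c(2) 6 sub
        by (intro conjI; simp del: One_nat_def)
      then show ?thesis
        by (rule maj) (simp_all add: 6 star_tails_def)
    next
      case sub: 2
      have "prefix_le P 1 (n - 1) [5, 3, 3, 2, 2]"
        unfolding prefix_le.simps using facts c(2) 6 sub
        by (intro conjI; simp del: One_nat_def)
      then show ?thesis
        by (rule maj) (simp_all add: 6 star_tails_def)
    next
      case sub: 3
      have "prefix_le P 1 (n - 1) [4, 4, 3, 3]"
        unfolding prefix_le.simps using facts c(2) 6 sub
        by (intro conjI; simp del: One_nat_def)
      then show ?thesis
        by (rule maj) (simp_all add: 6 star_tails_def)
    qed
  next
    case 7
    note facts = P1 P2_le P2[of 1] P2[of 2] P2[of 3] P2[of 4] P2[of 5] P2[of 6] P3_le P3[of 1] P3[of 2] P4 total[of 3] total[of 4] total[of 5] total[of 6] total[of 7] total[of 8]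
    have "P 3 \<le> n + 8" using P3_le 7 by simp
    \<comment> \<open>The fifth prefix separates the last two tails: \<open>[4, 4, 4, 4]\<close>
      allows \<open>P 5 = n + 15\<close>, the positivity bound, but \<open>[5, 4, 3, 3, 2]\<close>
      demands \<open>P 5 \<le> n + 14\<close>. This follows from \<open>P 2 = n + 4\<close> by
      \<open>k = 2\<close>, or from \<open>P 3 = n + 8\<close> by \<open>k = 3\<close>.\<close>
    consider "P 2 = n + 6"
      | "P 2 = n + 5"
      | "P 2 \<le> n + 4" "P 2 = n + 4 \<or> P 3 = n + 8"
      | "P 2 \<le> n + 3" "P 3 \<le> n + 7"
      using P2_le \<open>P 3 \<le> n + 8\<close> 7 by linarith
    then show ?thesis
    proof cases
      case sub: 1
      have "prefix_le P 1 (n - 1) [7, 2, 2, 2, 2, 2, 2]"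
        unfolding prefix_le.simps using facts c(2) 7 sub
        by (intro conjI; simp del: One_nat_def)
      then show ?thesis
        by (rule maj) (simp_all add: 7 star_tails_def)
    next
      case sub: 2
      have "prefix_le P 1 (n - 1) [6, 3, 3, 2, 2, 2]"
        unfolding prefix_le.simps using facts c(2) 7 sub
        by (intro conjI; simp del: One_nat_def)
      then show ?thesis
        by (rule maj) (simp_all add: 7 star_tails_def)
    next
      case sub: 3
      have "prefix_le P 1 (n - 1) [5, 4, 3, 3, 2]"
        unfolding prefix_le.simps using facts c(2) 7 sub
        by (intro conjI; auto simp del: One_nat_def)
      then show ?thesis
        by (rule maj) (simp_all add: 7 star_tails_def)
    next
      case sub: 4
      have "prefix_le P 1 (n - 1) [4, 4, 4, 4]"
        unfolding prefix_le.simps using facts c(2) 7 sub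
        by (intro conjI; simp del: One_nat_def)
      then show ?thesis
        by (rule maj) (simp_all add: 7 star_tails_def)
    qed
  qed
qed

section \<open>The minimal sequence\<close>

text \<open>For \<open>c \<ge> 1\<close> the total degree is \<open>2 * n + 2 * (c - 1)\<close>, so
  \<open>q = 2\<close> works while \<open>2 * (c - 1) \<le> n\<close>. Given
  \<open>n \<ge> c + 2\<close>, this fails only for three small pairs, which take
  \<open>q = 3\<close>; trees take \<open>q = 1\<close>.\<close>

lemma minimal_sequence_balanced:
  assumes "c \<le> 6" "c + 2 \<le> n"
  obtains q r where "r \<le> n" "2 * (n + c) = n * q + r + 2"
    "minimal_sequence c n = replicate r (Suc q) @ replicate (n - r) q"
proof -
  from assms(1) consider "c = 0" | "1 \<le> c" "2 * (c - 1) \<le> n" | "c = 5" "n = 7"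
    | "c = 6" "n = 8" | "c = 6" "n = 9"
    using assms(2) by linarith
  then show thesis
  proof cases
    case 1
    then show thesis
      using assms(2) by (intro that[of "n - 2" 1])
        (simp_all add: minimal_sequence_def blocks_def numeral_eq_Suc)
  next
    case 2
    from assms(1) have "minimal_sequence c n =
        replicate (2 * (c - 1)) 3 @ replicate (n - 2 * (c - 1)) 2"
      by (cases rule: le_6_cases) (use 2 in \<open>simp_all add: minimal_sequence_def blocks_def\<close>)
    with 2 show thesis by (intro that[of "2 * (c - 1)" 2]) simp_all
  next
    case 3
    then show thesis by (intro that[of 1 3]) (simp_all add: minimal_sequence_def blocks_def)
  next
    case 4
    then show thesis by (intro that[of 2 3]) (simp_all add: minimal_sequence_def blocks_def)
  next
    case 5
    then show thesis by (intro that[of 1 3]) (simp_all add: minimal_sequence_def blocks_def)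
  qed
qed

lemma minimal_sequence_majorized:
  assumes "c \<le> 6" "c + 2 \<le> n" "d \<in> cyclic_degree_sequences c n"
  shows "minimal_sequence c n \<unlhd> d"
proof -
  obtain q r where qr: "r \<le> n" "2 * (n + c) = n * q + r + 2"
    "minimal_sequence c n = replicate r (Suc q) @ replicate (n - r) q"
    using minimal_sequence_balanced[OF assms(1,2)] .
  have "2 \<le> n" using assms(2) by simp
  note props = cyclic_degree_sequences_props[OF assms(3) this]
  show ?thesis
    unfolding qr(3) using props(3) qr by (intro balanced_majorized[OF props(2,1)]) simp_all
qed

lemma minimal_sequence_realizable:
  assumes "c \<le> 6" "c + 2 \<le> n"
  shows "minimal_sequence c n \<in> cyclic_degree_sequences c n"
proof -
  have cycle: "minimal_sequence c n \<in> cyclic_degree_sequences c n"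
    if "map (\<lambda>v. 2 + incidences fs v) us @ replicate (n - L) 2 = minimal_sequence c n"
      "L \<le> n" "c > 0"
      "distinct fs \<and> (\<forall>(a, b)\<in>set fs. Suc a < b \<and> b < L \<and> (a, b) \<noteq> (0, n - 1)) \<and>
        Suc (length fs) = c"
      "distinct us \<and> set us = {..<L} \<and> sorted_wrt (\<ge>) (map (\<lambda>v. 2 + incidences fs v) us)"
    for fs us L
    using cycle_with_chords_realizable[of fs L n c us] that assms(2) by simp
  note simps = minimal_sequence_def blocks_def incidences_def
  from assms(1) show ?thesis
  proof (cases rule: le_6_cases)
    case 1
    define m where "m = n - 1"
    with assms have n: "n = Suc m" "0 < m" by auto
    \<comment> \<open>Degrees of a path; its two ends, of degree 1, are listed last.\<close>
    let ?d = "\<lambda>v. (if 0 < v then 1 else 0) + (if v < m then 1 else (0 :: nat))"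
    have "map ?d [1..<m] = map (\<lambda>_. 2) [1..<m]" by (rule map_cong) auto
    then have "map ?d [1..<m] = replicate (m - 1) 2" by (simp add: map_replicate_const)
    then have d: "map ?d ([1..<m] @ [0, m]) = replicate (m - 1) 2 @ [1, 1]"
      using \<open>0 < m\<close> by simp
    have "map ?d ([1..<m] @ [0, m]) \<in> cyclic_degree_sequences c (Suc m)"
    proof (rule path_with_chords_realizable[where fs = "[]"])
      show "sorted_wrt (\<ge>) (map ?d ([1..<m] @ [0, m]))"
        unfolding d by (auto simp: sorted_wrt_append sorted_wrt_replicate)
    qed (use \<open>0 < m\<close> 1 in \<open>auto simp: incidences_def\<close>)
    then show ?thesis
      unfolding d using 1 n by (simp add: simps numeral_eq_Suc)
  next
    case 2
    show ?thesis
      by (rule cycle[of "[]" "[]" 0]) (use 2 in \<open>simp_all add: simps\<close>)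
  next
    case 3
    \<comment> \<open>Vertex 1 has degree 2 but lies below \<open>L = 3\<close>, so one 2 is split
      off the replicated block.\<close>
    have "n - 2 = Suc (n - 3)" using assms(2) 3 by simp
    then have "minimal_sequence c n = [3, 3, 2] @ replicate (n - 3) 2"
      using 3 by (simp add: simps numeral_eq_Suc)
    then show ?thesis
      by (intro cycle[of "[(0, 2)]" "[0, 2, 1]" 3]) (use assms 3 in \<open>auto simp: incidences_def\<close>)
  next
    case 4
    \<comment> \<open>Here, and below whenever \<open>2 * (c - 1) \<le> n\<close>, the chords join
      \<open>i\<close> to \<open>i + c - 1\<close> and match the first \<open>2 * (c - 1)\<close>
      vertices perfectly, giving each degree 3.\<close>
    show ?thesis
      by (rule cycle[of "[(0, 2), (1, 3)]" "[0, 1, 2, 3]" 4])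
        (use assms 4 in \<open>simp_all add: simps numeral_eq_Suc, (auto)?\<close>)
  next
    case 5
    show ?thesis
      by (rule cycle[of "[(0, 3), (1, 4), (2, 5)]" "[0, 1, 2, 3, 4, 5]" 6])
        (use assms 5 in \<open>simp_all add: simps numeral_eq_Suc, (auto)?\<close>)
  next
    case 6
    show ?thesis
    proof (cases "n = 7")
      case True
      \<comment> \<open>Four chords have eight ends on seven vertices; vertex 0 takes two of them
        and gets degree 4.\<close>
      show ?thesis
        by (rule cycle[of "[(0, 2), (0, 4), (1, 5), (3, 6)]" "[0, 1, 2, 3, 4, 5, 6]" 7])
          (use 6 True in \<open>simp_all add: simps numeral_eq_Suc, (auto)?\<close>)
    next
      case False
      show ?thesis
        by (rule cycle[of "[(0, 4), (1, 5), (2, 6), (3, 7)]" "[0, 1, 2, 3, 4, 5, 6, 7]" 8])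
          (use assms 6 False in \<open>simp_all add: simps numeral_eq_Suc, (auto)?\<close>)
    qed
  next
    case 7
    consider "n = 8" | "n = 9" | "10 \<le> n" using assms(2) 7 by linarith
    then show ?thesis
    proof cases
      case 1
      \<comment> \<open>Five chords have ten ends: on eight vertices 0 and 1 take two each, on nine
        vertices only 0 does.\<close>
      show ?thesis
        by (rule cycle[of "[(0, 3), (0, 6), (1, 4), (1, 7), (2, 5)]" "[0, 1, 2, 3, 4, 5, 6, 7]" 8])
          (use 7 1 in \<open>simp_all add: simps numeral_eq_Suc, (auto)?\<close>)
    next
      case 2
      show ?thesis
        by (rule cycle[of "[(0, 2), (0, 4), (1, 5), (3, 7), (6, 8)]" "[0, 1, 2, 3, 4, 5, 6, 7, 8]" 9])
          (use 7 2 in \<open>simp_all add: simps numeral_eq_Suc, (auto)?\<close>)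
    next
      case 3
      show ?thesis
        by (rule cycle[of "[(0, 5), (1, 6), (2, 7), (3, 8), (4, 9)]"
              "[0, 1, 2, 3, 4, 5, 6, 7, 8, 9]" 10])
          (use 7 3 in \<open>simp_all add: simps numeral_eq_Suc, (auto)?\<close>)
    qed
  qed
qed

theorem mainTheorem2:
  fixes c n :: nat
  assumes "c \<le> 6" and "n \<ge> c + 2"
  shows "maximal_elements (cyclic_degree_sequences c n) = set (maximal_sequences c n) \<and>
    distinct (maximal_sequences c n) \<and>
    pairwise (\<lambda>y z. \<not> y \<unlhd> z \<and> \<not> z \<unlhd> y) (set (maximal_sequences c n)) \<and>
    (\<forall>d\<in>cyclic_degree_sequences c n. \<exists>z\<in>set (maximal_sequences c n). d \<unlhd> z) \<and>
    minimal_elements (cyclic_degree_sequences c n) = {minimal_sequence c n} \<and>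
    (\<forall>d\<in>cyclic_degree_sequences c n. minimal_sequence c n \<unlhd> d)"
proof -
  let ?D = "cyclic_degree_sequences c n" and ?M = "set (maximal_sequences c n)"
  have M: "?M = star_sequence n ` set (star_tails c)"
    by (simp add: maximal_sequences_eq[OF assms])
  have upper: "\<exists>z\<in>?M. d \<unlhd> z" if "d \<in> ?D" for d
    using majorized_by_star_tail[OF assms that] unfolding M by blast
  have realizable: "z \<in> ?D" if "z \<in> ?M" for z
    using that star_tails_realizable[OF assms] unfolding M by blast
  have incomparable: "\<not> y \<unlhd> z" if "y \<in> ?M" "z \<in> ?M" "y \<noteq> z" for y z
    using that star_tails_incomparable[OF assms] unfolding M by blast
  \<comment> \<open>If two tails gave the same sequence, it would be majorized by itself, against
    the incomparability of distinct tails. Its reflexivity comes from \<open>upper\<close>, since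
    the candidate above it can only be itself.\<close>
  have inj: "inj_on (star_sequence n) (set (star_tails c))"
  proof (rule inj_onI, rule ccontr)
    fix xs ys
    assume tails: "xs \<in> set (star_tails c)" "ys \<in> set (star_tails c)"
      and eq: "star_sequence n xs = star_sequence n ys" and "xs \<noteq> ys"
    obtain z where "z \<in> ?M" "star_sequence n xs \<unlhd> z"
      using upper realizable tails(1) M by blast
    with incomparable tails(1) M have "star_sequence n xs \<unlhd> star_sequence n xs"
      by blast
    with star_tails_incomparable[OF assms tails \<open>xs \<noteq> ys\<close>] eq show False by simp
  qed
  have "maximal_elements ?D = ?M"
  proof (intro equalityI subsetI)
    fix z assume "z \<in> ?M"
    \<comment> \<open>Some candidate lies above \<open>e\<close>, hence above \<open>z\<close>, so
      it is \<open>z\<close> itself; antisymmetry then identifies \<open>e\<close> with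
      \<open>z\<close>.\<close>
    have "e = z" if e: "e \<in> ?D" "z \<unlhd> e" for e
    proof -
      obtain z' where "z' \<in> ?M" "e \<unlhd> z'" using upper e(1) by blast
      then have "z' = z"
        using incomparable[OF \<open>z \<in> ?M\<close>] majorized_trans[OF e(2)] by blast
      with \<open>e \<unlhd> z'\<close> e(2) show ?thesis using majorized_antisym by blast
    qed
    then show "z \<in> maximal_elements ?D"
      using realizable[OF \<open>z \<in> ?M\<close>] by (simp add: maximal_elements_def)
  next
    fix d assume "d \<in> maximal_elements ?D"
    then show "d \<in> ?M"
      using upper realizable unfolding maximal_elements_def by blast
  qed
  moreover have "distinct (maximal_sequences c n)"
    using inj by (simp add: maximal_sequences_eq[OF assms] distinct_map distinct_star_tails)
  moreover have "pairwise (\<lambda>y z. \<not> y \<unlhd> z \<and> \<not> z \<unlhd> y) ?M"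
    using incomparable by (auto simp: pairwise_def)
  moreover have lower: "\<forall>d\<in>?D. minimal_sequence c n \<unlhd> d"
    using minimal_sequence_majorized[OF assms] by blast
  moreover have "minimal_elements ?D = {minimal_sequence c n}"
    using minimal_sequence_realizable[OF assms] lower majorized_antisym
    unfolding minimal_elements_def by blast
  ultimately show ?thesis using upper by blast
qed

end
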